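(* Let $(\Gamma,w,* )$ be a connected fair and balanced $\delta$-graph, with tracial cover $\Gamma_{tr}$. The group $T(\Gamma)$ acts on $\Gamma_{tr}$ by $\lambda\cdot[\omega,v]=[\omega\lambda,v]$, and the quotient graph of $\Gamma_{tr}$ by this action recovers $\Gamma$: $(\Gamma_{tr})^{T(\Gamma)}\cong\Gamma$ as weighted directed graphs.
   Context: **Fair and balanced $\delta$-graphs.** A fair and balanced $\delta$-graph is a locally finite directed graph $\Gamma$ (multiple edges and self-loops allowed) with edge weights $w:E(\Gamma)\to\mathbb{R}_{>0}$ and a distinguished vertex $*$, such that (i) there is an involution $e\mapsto\overline e$ of $E(\Gamma)$ with $s(\overline e)=t(e)$, $t(\overline e)=s(e)$ and $w(e)w(\overline e)=1$; (ii) $\sum_{s(e)=x}w(e)=\delta$ for every vertex $x$. A path is a (possibly empty) sequence of edges $e_1,\dots,e_k$ with $s(e_i)=t(e_{i-1})$, of weight $w(e_1)\cdots w(e_k)$; a loop based at $v$ is a path from $v$ to $v$. $T(\Gamma)=\{w(\ell):\ell\text{ a loop based at }*\}$, a subgroup of $\mathbb{R}_{>0}$. **Tracial cover.** $\Gamma_{tr}$ has as vertices the pairs $[\lambda,v]$ with $v\in V(\Gamma)$ and $\lambda$ the weight of some path from $*$ to $v$; the edges from $[\lambda,v]$ to $[\lambda',v']$ correspond to the edges $e$ of $\Gamma$ with $s(e)=v$, $t(e)=v'$, $w(e)=\lambda'/\lambda$, and carry weight $w(e)$. **Quotient graph.** For a graph $\Lambda$ with edge weights and a group $H$ acting on it by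 weight-preserving graph automorphisms, $\Lambda^H$ is the weighted graph whose vertices are the $H$-orbits of $V(\Lambda)$; for an orbit with chosen representative $x$, the edges from $[x]$ to $[y]$ are in bijection with the edges $x\to y'$ of $\Lambda$ with $y'\in[y]$, with the same weight (independent of the representative up to isomorphism). *)

theory Defs
  imports
    "HOL-Algebra.Group_Action"
    "Graph_Theory.Digraph_Component"
    "Graph_Theory.Digraph_Isomorphism"
    "Graph_Theory.Weighted_Graph"
begin

text \<open>
  The involution is required to exist but is not part of the data; it may fix a self-loop, so
  \<^verbatim>\<open>bidirected_digraph\<close>, whose reversal is fixed-point free on arcs, is too restrictive here.
\<close>
locale fair_balanced_graph = wf_digraph G
  for G :: "('v, 'e) pre_digraph" +
  fixes w :: "'e weight_fun" and bp :: 'v and \<delta> :: real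
  assumes basepoint: "bp \<in> verts G"
    and locally_finite: "\<And>x. x \<in> verts G \<Longrightarrow> finite (out_arcs G x) \<and> finite (in_arcs G x)"
    and weight_pos: "\<And>e. e \<in> arcs G \<Longrightarrow> w e > 0"
    and balanced:
      "\<exists>rev. \<forall>e \<in> arcs G. rev e \<in> arcs G \<and> rev (rev e) = e \<and>
         tail G (rev e) = head G e \<and> head G (rev e) = tail G e \<and> w e * w (rev e) = 1"
    and fair: "\<And>x. x \<in> verts G \<Longrightarrow> (\<Sum>e \<in> out_arcs G x. w e) = \<delta>"

definition path_weight :: "'e weight_fun \<Rightarrow> 'e awalk \<Rightarrow> real" where
  "path_weight w p = prod_list (map w p)"

definition loop_weights :: "('v, 'e) pre_digraph \<Rightarrow> 'e weight_fun \<Rightarrow> 'v \<Rightarrow> real set" where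
  "loop_weights G w bp = {path_weight w p | p. pre_digraph.awalk G bp p bp}"

definition pos_real_group :: "real monoid" where
  "pos_real_group = \<lparr>carrier = {0<..}, monoid.mult = (*), one = 1\<rparr>"

definition loop_weight_group :: "('v, 'e) pre_digraph \<Rightarrow> 'e weight_fun \<Rightarrow> 'v \<Rightarrow> real monoid" where
  "loop_weight_group G w bp = pos_real_group\<lparr>carrier := loop_weights G w bp\<rparr>"

definition tracial_verts ::
    "('v, 'e) pre_digraph \<Rightarrow> 'e weight_fun \<Rightarrow> 'v \<Rightarrow> (real \<times> 'v) set" where
  "tracial_verts G w bp = {(path_weight w p, v) | p v. pre_digraph.awalk G bp p v}"

type_synonym ('v, 'e) tracial_arc = "(real \<times> 'v) \<times> 'e \<times> (real \<times> 'v)"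

definition tracial_arcs ::
    "('v, 'e) pre_digraph \<Rightarrow> 'e weight_fun \<Rightarrow> 'v \<Rightarrow> ('v, 'e) tracial_arc set" where
  "tracial_arcs G w bp =
     {((l, v), e, (l', v')) | l v e l' v'.
        (l, v) \<in> tracial_verts G w bp \<and> (l', v') \<in> tracial_verts G w bp \<and>
        e \<in> arcs G \<and> tail G e = v \<and> head G e = v' \<and> w e = l' / l}"

definition tracial_cover ::
    "('v, 'e) pre_digraph \<Rightarrow> 'e weight_fun \<Rightarrow> 'v \<Rightarrow> (real \<times> 'v, ('v, 'e) tracial_arc) pre_digraph" where
  "tracial_cover G w bp =
     \<lparr>verts = tracial_verts G w bp, arcs = tracial_arcs G w bp,
      tail = (\<lambda>(x, e, y). x), head = (\<lambda>(x, e, y). y)\<rparr>"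

definition tracial_weight :: "'e weight_fun \<Rightarrow> ('v, 'e) tracial_arc weight_fun" where
  "tracial_weight w = (\<lambda>(x, e, y). w e)"

text \<open>The restrictions are needed because \<^const>\<open>BijGroup\<close> consists of extensional functions.\<close>

definition tracial_act ::
    "('v, 'e) pre_digraph \<Rightarrow> 'e weight_fun \<Rightarrow> 'v \<Rightarrow> real \<Rightarrow> real \<times> 'v \<Rightarrow> real \<times> 'v" where
  "tracial_act G w bp l = (\<lambda>(om, v) \<in> tracial_verts G w bp. (om * l, v))"

definition tracial_act_arcs ::
    "('v, 'e) pre_digraph \<Rightarrow> 'e weight_fun \<Rightarrow> 'v \<Rightarrow> real \<Rightarrow> ('v, 'e) tracial_arc \<Rightarrow> ('v, 'e) tracial_arc" where
  "tracial_act_arcs G w bp l =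
     (\<lambda>(x, e, y) \<in> tracial_arcs G w bp. (tracial_act G w bp l x, e, tracial_act G w bp l y))"

locale weighted_digraph_action =
  wf_digraph L + verts: group_action H "verts L" \<phi> + arcs: group_action H "arcs L" \<psi>
  for H :: "('g, 'm) monoid_scheme" and L :: "('v, 'e) pre_digraph" and w :: "'e weight_fun"
    and \<phi> :: "'g \<Rightarrow> 'v \<Rightarrow> 'v" and \<psi> :: "'g \<Rightarrow> 'e \<Rightarrow> 'e" +
  assumes tail_act: "\<And>h a. h \<in> carrier H \<Longrightarrow> a \<in> arcs L \<Longrightarrow> tail L (\<psi> h a) = \<phi> h (tail L a)"
    and head_act: "\<And>h a. h \<in> carrier H \<Longrightarrow> a \<in> arcs L \<Longrightarrow> head L (\<psi> h a) = \<phi> h (head L a)"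
    and weight_act: "\<And>h a. h \<in> carrier H \<Longrightarrow> a \<in> arcs L \<Longrightarrow> w (\<psi> h a) = w a"

definition orbit_representatives ::
    "('g, 'm) monoid_scheme \<Rightarrow> 'v set \<Rightarrow> ('g \<Rightarrow> 'v \<Rightarrow> 'v) \<Rightarrow> ('v set \<Rightarrow> 'v) \<Rightarrow> bool" where
  "orbit_representatives H V \<phi> rep \<longleftrightarrow> (\<forall>X \<in> orbits H V \<phi>. rep X \<in> X)"

text \<open>
  The arcs of the quotient are the arcs of the graph that start at a chosen representative;
  they keep their weight, so the quotient has the same weight function.
\<close>
definition quotient_digraph ::
    "('g, 'm) monoid_scheme \<Rightarrow> ('g \<Rightarrow> 'v \<Rightarrow> 'v) \<Rightarrow> ('v set \<Rightarrow> 'v) \<Rightarrow> ('v, 'e) pre_digraph \<Rightarrow>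
      ('v set, 'e) pre_digraph" where
  "quotient_digraph H \<phi> rep L =
     \<lparr>verts = orbits H (verts L) \<phi>,
      arcs = {a \<in> arcs L. tail L a \<in> rep ` orbits H (verts L) \<phi>},
      tail = (\<lambda>a. orbit H \<phi> (tail L a)), head = (\<lambda>a. orbit H \<phi> (head L a))\<rparr>"

definition weighted_digraph_iso ::
    "('a, 'b) pre_digraph \<Rightarrow> 'b weight_fun \<Rightarrow> ('c, 'd) pre_digraph \<Rightarrow> 'd weight_fun \<Rightarrow> bool" where
  "weighted_digraph_iso G w G' w' \<longleftrightarrow>
     (\<exists>f. pre_digraph.digraph_isomorphism G f \<and> G' = app_iso f G \<and>
        (\<forall>a \<in> arcs G. w' (iso_arcs f a) = w a))"

end

(*
  Balance lets every path be run backwards with inverse weight. Hence two tracial vertices over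
  the same vertex of the graph differ by the weight of a loop at the base point, so the orbits of
  the action are exactly the fibres of the projection (l, v) |-> v, and connectedness makes every
  fibre nonempty. An arc of the tracial cover is determined by its tail and the underlying arc,
  so the projection maps the arcs leaving a representative bijectively to the arcs leaving v.
*)
theory Submission
  imports Defs
begin

section \<open>Computation rules, and a criterion for group actions\<close>

lemma path_weight_simps [simp]:
  "path_weight w [] = 1"
  "path_weight w (e # p) = w e * path_weight w p"
  "path_weight w (p @ q) = path_weight w p * path_weight w q"
  by (simp_all add: path_weight_def)

lemma pos_real_group_simps [simp]:
  "carrier pos_real_group = {0<..}" "x \<otimes>\<^bsub>pos_real_group\<^esub> y = x * y" "\<one>\<^bsub>pos_real_group\<^esub> = 1"
  by (simp_all add: pos_real_group_def)

lemma group_pos_real_group: "group pos_real_group"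
proof (rule groupI)
  fix x assume "x \<in> carrier pos_real_group"
  then show "\<exists>y\<in>carrier pos_real_group. y \<otimes>\<^bsub>pos_real_group\<^esub> x = \<one>\<^bsub>pos_real_group\<^esub>"
    by (intro bexI[of _ "inverse x"]) auto
qed auto

lemma loop_weight_group_simps [simp]:
  "carrier (loop_weight_group G w bp) = loop_weights G w bp"
  "x \<otimes>\<^bsub>loop_weight_group G w bp\<^esub> y = x * y" "\<one>\<^bsub>loop_weight_group G w bp\<^esub> = 1"
  by (simp_all add: loop_weight_group_def)

lemma tracial_cover_simps [simp]:
  "verts (tracial_cover G w bp) = tracial_verts G w bp"
  "arcs (tracial_cover G w bp) = tracial_arcs G w bp"
  "tail (tracial_cover G w bp) (x, e, y) = x"
  "head (tracial_cover G w bp) (x, e, y) = y"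
  by (simp_all add: tracial_cover_def)

lemma tracial_act_simp [simp]:
  "(l, v) \<in> tracial_verts G w bp \<Longrightarrow> tracial_act G w bp k (l, v) = (l * k, v)"
  by (simp add: tracial_act_def)

lemma tracial_act_arcs_simp [simp]:
  "(x, e, y) \<in> tracial_arcs G w bp \<Longrightarrow>
    tracial_act_arcs G w bp k (x, e, y) = (tracial_act G w bp k x, e, tracial_act G w bp k y)"
  by (simp add: tracial_act_arcs_def)

text \<open>Bijectivity of each \<open>\<phi> h\<close> comes for free: the pointwise laws make
  \<open>\<phi>\<close> of the inverse a two-sided inverse on \<open>E\<close>. Extensionality turns
  the pointwise product law into the equality of functions that a homomorphism into
  \<open>BijGroup E\<close> requires.\<close>

lemma group_actionI:
  assumes "group H"
    and ext: "\<And>h. h \<in> carrier H \<Longrightarrow> \<phi> h \<in> extensional E"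
    and closed: "\<And>h x. h \<in> carrier H \<Longrightarrow> x \<in> E \<Longrightarrow> \<phi> h x \<in> E"
    and one: "\<And>x. x \<in> E \<Longrightarrow> \<phi> \<one>\<^bsub>H\<^esub> x = x"
    and mult: "\<And>g h x. g \<in> carrier H \<Longrightarrow> h \<in> carrier H \<Longrightarrow> x \<in> E \<Longrightarrow> \<phi> (g \<otimes>\<^bsub>H\<^esub> h) x = \<phi> g (\<phi> h x)"
  shows "group_action H E \<phi>"
proof -
  interpret group H by fact
  have bij: "\<phi> h \<in> Bij E" if h: "h \<in> carrier H" for h
  proof -
    have "\<phi> h (\<phi> (inv\<^bsub>H\<^esub> h) x) = x \<and> \<phi> (inv\<^bsub>H\<^esub> h) (\<phi> h x) = x" if "x \<in> E" for x
      using mult[of h "inv\<^bsub>H\<^esub> h" x] mult[of "inv\<^bsub>H\<^esub> h" h x] one h that by simp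
    then have "bij_betw (\<phi> h) E E"
      using closed h by (intro bij_betwI[of _ _ _ "\<phi> (inv\<^bsub>H\<^esub> h)"]) auto
    then show ?thesis
      using ext h by (simp add: Bij_def)
  qed
  have "\<phi> (g \<otimes>\<^bsub>H\<^esub> h) = compose E (\<phi> g) (\<phi> h)" if "g \<in> carrier H" "h \<in> carrier H" for g h
    using that mult ext by (intro extensionalityI[of _ E]) (auto simp: compose_eq compose_extensional)
  then have "\<phi> \<in> hom H (BijGroup E)"
    using bij by (intro homI) (auto simp: BijGroup_def)
  then show ?thesis
    using group_BijGroup by (intro group_action.intro group_hom.intro group_hom_axioms.intro) (auto intro: assms)
qed

section \<open>Reversal of paths and the group of loop weights\<close>

context fair_balanced_graph
begin

lemma path_weight_pos: "awalk u p v \<Longrightarrow> path_weight w p > 0"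
  by (induction p arbitrary: u) (auto simp: awalk_Cons_iff weight_pos)

text \<open>Replace each edge by its partner under the involution and traverse the partners in the
  opposite order; each edge cancels against its partner in the product. In the induction, the
  partner of the first edge goes to the end of the reversed remainder.\<close>

lemma exists_reverse_awalk:
  assumes "awalk u p v"
  shows "\<exists>q. awalk v q u \<and> path_weight w p * path_weight w q = 1"
  using assms
proof (induction p arbitrary: u)
  case Nil
  then show ?case
    by (auto simp: awalk_Nil_iff intro!: exI[of _ "[]"])
next
  case (Cons e p)
  then have e: "e \<in> arcs G" "tail G e = u" and p: "awalk (head G e) p v"
    by (auto simp: awalk_Cons_iff)
  from Cons.IH[OF p] obtain q
    where q: "awalk v q (head G e)" "path_weight w p * path_weight w q = 1" by blast
  from balanced e obtain e'
    where e': "e' \<in> arcs G" "tail G e' = head G e" "head G e' = u" "w e * w e' = 1" by metis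
  have "awalk v (q @ [e']) u"
    using q e' by (auto simp: awalk_append_iff awalk_Cons_iff awalk_Nil_iff)
  moreover have "path_weight w (e # p) * path_weight w (q @ [e'])
      = (w e * w e') * (path_weight w p * path_weight w q)"
    by (simp add: mult_ac)
  then have "path_weight w (e # p) * path_weight w (q @ [e']) = 1"
    using q e' by simp
  ultimately show ?case
    by blast
qed

lemma loop_weights_pos: "l \<in> loop_weights G w bp \<Longrightarrow> l > 0"
  by (auto simp: loop_weights_def path_weight_pos)

text \<open>The empty loop, the reversed loop and concatenation give nonemptiness, inverses and
  products.\<close>

lemma subgroup_loop_weights: "subgroup (loop_weights G w bp) pos_real_group"
proof -
  interpret group pos_real_group by (rule group_pos_real_group)
  show ?thesis
  proof (rule subgroupI)
    show "loop_weights G w bp \<subseteq> carrier pos_real_group"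
      using loop_weights_pos by auto
    have "awalk bp [] bp"
      using basepoint by (simp add: awalk_Nil_iff)
    then show "loop_weights G w bp \<noteq> {}"
      unfolding loop_weights_def by blast
  next
    fix a assume a: "a \<in> loop_weights G w bp"
    then obtain p where "awalk bp p bp" and ap: "a = path_weight w p"
      unfolding loop_weights_def by blast
    then obtain q where q: "awalk bp q bp" "path_weight w p * path_weight w q = 1"
      using exists_reverse_awalk by blast
    then have "inv\<^bsub>pos_real_group\<^esub> a = path_weight w q"
      using ap loop_weights_pos[OF a] path_weight_pos[OF q(1)]
      by (intro inv_equality) (auto simp: mult.commute)
    then show "inv\<^bsub>pos_real_group\<^esub> a \<in> loop_weights G w bp"
      using q unfolding loop_weights_def by blast
  next
    fix a b assume "a \<in> loop_weights G w bp" "b \<in> loop_weights G w bp"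
    then obtain p q where "awalk bp p bp" "awalk bp q bp" "a = path_weight w p" "b = path_weight w q"
      unfolding loop_weights_def by blast
    then have "awalk bp (p @ q) bp" "a * b = path_weight w (p @ q)"
      by auto
    then show "a \<otimes>\<^bsub>pos_real_group\<^esub> b \<in> loop_weights G w bp"
      unfolding loop_weights_def pos_real_group_simps by blast
  qed
qed

lemma group_loop_weight_group: "group (loop_weight_group G w bp)"
  unfolding loop_weight_group_def
  by (rule subgroup.subgroup_is_group[OF subgroup_loop_weights group_pos_real_group])

section \<open>Vertices and arcs of the tracial cover\<close>

lemma tracial_verts_pos: "(l, v) \<in> tracial_verts G w bp \<Longrightarrow> l > 0"
  by (auto simp: tracial_verts_def path_weight_pos)

text \<open>Run through the loop of weight \<open>k\<close> before following a path of weight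
  \<open>l\<close> to \<open>v\<close>.\<close>

lemma tracial_verts_act:
  assumes "k \<in> loop_weights G w bp" "(l, v) \<in> tracial_verts G w bp"
  shows "(l * k, v) \<in> tracial_verts G w bp"
proof -
  obtain p q where "awalk bp p bp" "k = path_weight w p" "awalk bp q v" "l = path_weight w q"
    using assms unfolding loop_weights_def tracial_verts_def by blast
  then have "awalk bp (p @ q) v" "l * k = path_weight w (p @ q)"
    by auto
  then show ?thesis
    unfolding tracial_verts_def by blast
qed

lemma tracial_verts_step:
  assumes "(l, tail G e) \<in> tracial_verts G w bp" "e \<in> arcs G"
  shows "(l * w e, head G e) \<in> tracial_verts G w bp"
proof -
  obtain p where "awalk bp p (tail G e)" "l = path_weight w p"
    using assms(1) unfolding tracial_verts_def by blast
  then have "awalk bp (p @ [e]) (head G e)" "l * w e = path_weight w (p @ [e])"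
    using assms(2) by (auto simp: awalk_append_iff awalk_Cons_iff awalk_Nil_iff)
  then show ?thesis
    unfolding tracial_verts_def by blast
qed

text \<open>A path of weight \<open>l'\<close> to \<open>v\<close>, followed by the reverse of one
  of weight \<open>l\<close>, is a loop at the base point.\<close>

lemma tracial_verts_ratio:
  assumes "(l, v) \<in> tracial_verts G w bp" "(l', v) \<in> tracial_verts G w bp"
  shows "l' / l \<in> loop_weights G w bp"
proof -
  obtain p p' where p: "awalk bp p v" "l = path_weight w p" and p': "awalk bp p' v" "l' = path_weight w p'"
    using assms unfolding tracial_verts_def by blast
  obtain q where q: "awalk v q bp" "path_weight w p * path_weight w q = 1"
    using exists_reverse_awalk p(1) by blast
  have "awalk bp (p' @ q) bp"
    using p' q by auto
  moreover have "l' / l = path_weight w (p' @ q)"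
    using p p' q path_weight_pos[OF p(1)] by (simp add: field_simps)
  ultimately show ?thesis
    unfolding loop_weights_def by blast
qed

text \<open>This is unique lifting of edges. As labels are positive, \<open>w e = l' / l\<close> can
  be solved for \<open>l'\<close>, and by \<open>tracial_verts_step\<close> the resulting head is
  automatically a tracial vertex.\<close>

lemma tracial_arcs_iff:
  "(x, e, y) \<in> tracial_arcs G w bp \<longleftrightarrow>
    x \<in> tracial_verts G w bp \<and> e \<in> arcs G \<and> snd x = tail G e \<and> y = (fst x * w e, head G e)"
proof (cases x; cases y)
  fix l v l' v' assume "x = (l, v)" "y = (l', v')"
  moreover have "l > 0" if "(l, v) \<in> tracial_verts G w bp"
    using that by (rule tracial_verts_pos)
  ultimately show ?thesis
    using tracial_verts_step[of l e] unfolding tracial_arcs_def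
    by (auto simp: field_simps)
qed

lemma tracial_arcs_verts:
  assumes "(x, e, y) \<in> tracial_arcs G w bp"
  shows "x \<in> tracial_verts G w bp" "y \<in> tracial_verts G w bp"
  using assms by (auto simp: tracial_arcs_def)

section \<open>The action of the loop weights on the cover\<close>

lemma wf_digraph_tracial_cover: "wf_digraph (tracial_cover G w bp)"
  by unfold_locales (auto dest: tracial_arcs_verts)

lemma weighted_digraph_action_tracial_cover:
  "weighted_digraph_action (loop_weight_group G w bp) (tracial_cover G w bp) (tracial_weight w)
    (tracial_act G w bp) (tracial_act_arcs G w bp)"
proof (intro weighted_digraph_action.intro weighted_digraph_action_axioms.intro)
  show "wf_digraph (tracial_cover G w bp)"
    by (rule wf_digraph_tracial_cover)
  show "group_action (loop_weight_group G w bp) (verts (tracial_cover G w bp)) (tracial_act G w bp)"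
  proof (rule group_actionI[OF group_loop_weight_group])
    fix h assume "h \<in> carrier (loop_weight_group G w bp)"
    show "tracial_act G w bp h \<in> extensional (verts (tracial_cover G w bp))"
      by (simp add: tracial_act_def)
  next
    fix g h x assume "g \<in> carrier (loop_weight_group G w bp)" "h \<in> carrier (loop_weight_group G w bp)"
      "x \<in> verts (tracial_cover G w bp)"
    then show "tracial_act G w bp (g \<otimes>\<^bsub>loop_weight_group G w bp\<^esub> h) x
        = tracial_act G w bp g (tracial_act G w bp h x)"
      \<comment> \<open>Labels are multiplied on the right, so the law for a left action needs
        \<open>g\<close> and \<open>h\<close> to commute.\<close>
      by (cases x) (simp add: tracial_verts_act mult.assoc mult.commute[of g h])
  qed (auto simp: tracial_verts_act)
  \<comment> \<open>For an arc over \<open>e\<close> with tail label \<open>l\<close>, the identity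
    \<open>(l * w e) * h = (l * h) * w e\<close> shows that the shifted triple is the lift of
    \<open>e\<close> at the shifted tail.\<close>
  have arc_closed: "tracial_act_arcs G w bp h a \<in> tracial_arcs G w bp"
    if "h \<in> loop_weights G w bp" "a \<in> tracial_arcs G w bp" for h a
    using that tracial_verts_step by (cases a) (auto simp: tracial_arcs_iff tracial_verts_act mult_ac)
  show "group_action (loop_weight_group G w bp) (arcs (tracial_cover G w bp)) (tracial_act_arcs G w bp)"
  proof (rule group_actionI[OF group_loop_weight_group])
    fix h assume h: "h \<in> carrier (loop_weight_group G w bp)"
    show "tracial_act_arcs G w bp h \<in> extensional (arcs (tracial_cover G w bp))"
      by (simp add: tracial_act_arcs_def)
    fix a assume a: "a \<in> arcs (tracial_cover G w bp)"
    show "tracial_act_arcs G w bp h a \<in> arcs (tracial_cover G w bp)"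
      using arc_closed h a by simp
  next
    fix a assume "a \<in> arcs (tracial_cover G w bp)"
    then show "tracial_act_arcs G w bp \<one>\<^bsub>loop_weight_group G w bp\<^esub> a = a"
      by (cases a) (auto dest: tracial_arcs_verts)
  next
    fix g h a
    assume g: "g \<in> carrier (loop_weight_group G w bp)" and h: "h \<in> carrier (loop_weight_group G w bp)"
      and a: "a \<in> arcs (tracial_cover G w bp)"
    obtain l v e l' v' where a_eq: "a = ((l, v), e, (l', v'))"
      by (metis prod.exhaust)
    have v: "(l, v) \<in> tracial_verts G w bp" "(l', v') \<in> tracial_verts G w bp"
      using a a_eq tracial_arcs_verts by auto
    \<comment> \<open>\<open>tracial_act_arcs\<close> is specified only on arcs, so the triple
      shifted by \<open>h\<close> must be known to be an arc before \<open>g\<close> can be applied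
      to it.\<close>
    have "((l * h, v), e, (l' * h, v')) \<in> tracial_arcs G w bp"
      using arc_closed[of h a] g h a a_eq v by simp
    then show "tracial_act_arcs G w bp (g \<otimes>\<^bsub>loop_weight_group G w bp\<^esub> h) a
        = tracial_act_arcs G w bp g (tracial_act_arcs G w bp h a)"
      using a a_eq v h by (simp add: tracial_verts_act mult.assoc mult.commute[of g h])
  qed
qed (auto simp: tracial_weight_def)

section \<open>Orbits as fibres, and the quotient\<close>

lemma orbit_tracial_act:
  assumes "x \<in> tracial_verts G w bp"
  shows "orbit (loop_weight_group G w bp) (tracial_act G w bp) x
    = {y \<in> tracial_verts G w bp. snd y = snd x}"
proof -
  obtain l v where x: "x = (l, v)" by (cases x)
  have l: "l > 0"
    using assms tracial_verts_pos x by blast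
  \<comment> \<open>Transitivity on the fibre: the ratio of the two labels is a loop weight. The
    other inclusion holds because the action fixes the second coordinate.\<close>
  have "\<exists>k \<in> loop_weights G w bp. l' = l * k" if "(l', v) \<in> tracial_verts G w bp" for l'
    using tracial_verts_ratio[OF _ that] assms x l by (intro bexI[of _ "l' / l"]) auto
  then show ?thesis
    using assms x unfolding orbit_def by (auto simp: tracial_verts_act) blast
qed

text \<open>Connectedness ignores the direction of arcs, but the involution makes \<open>G\<close>
  symmetric, so it yields directed paths.\<close>

lemma awalk_from_basepoint:
  assumes "Digraph_Component.connected G" "v \<in> verts G"
  shows "\<exists>p. awalk bp p v"
proof -
  have "symmetric G"
    unfolding symmetric_conv using balanced by metis
  then have "strongly_connected G"
    using assms by (intro symmetric_connected_imp_strongly_connected)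
  then show ?thesis
    using assms basepoint by (auto simp: strongly_connected_def reachable_awalk)
qed

lemma weighted_digraph_iso_quotient_tracial_cover:
  assumes conn: "Digraph_Component.connected G"
    and rep: "orbit_representatives (loop_weight_group G w bp)
        (verts (tracial_cover G w bp)) (tracial_act G w bp) rep"
  shows "weighted_digraph_iso
        (quotient_digraph (loop_weight_group G w bp) (tracial_act G w bp) rep (tracial_cover G w bp))
        (tracial_weight w) G w"
proof -
  let ?V = "tracial_verts G w bp"
  let ?O = "orbits (loop_weight_group G w bp) ?V (tracial_act G w bp)"
  let ?Q = "quotient_digraph (loop_weight_group G w bp) (tracial_act G w bp) rep (tracial_cover G w bp)"
  define fibre where "fibre v = {y \<in> ?V. snd y = v}" for v
  \<comment> \<open>Connectedness enters here, to make every fibre nonempty.\<close>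
  have snd_V: "snd ` ?V = verts G"
    using awalk_from_basepoint[OF conn] by (force simp: tracial_verts_def image_iff)
  have "?O = (\<lambda>x. fibre (snd x)) ` ?V"
    unfolding orbits_def setcompr_eq_image Collect_mem_eq
    by (rule image_cong) (simp_all add: orbit_tracial_act fibre_def)
  then have O: "?O = fibre ` verts G"
    unfolding snd_V[symmetric] image_image .
  have rep_fibre: "rep (fibre v) \<in> ?V" "snd (rep (fibre v)) = v" if "v \<in> verts G" for v
    using rep O that by (auto simp: orbit_representatives_def fibre_def)
  \<comment> \<open>Both maps are induced by the projection to \<open>G\<close>.
    \<open>app_iso\<close> takes its end maps from the last two fields; choosing those of
    \<open>G\<close> makes the image equal to \<open>G\<close> as a record, not merely on its
    arcs.\<close>
  define f :: "((real \<times> 'v) set, ('v, 'e) tracial_arc, 'v, 'e) digraph_isomorphism" where "f = \<lparr>iso_verts = (\<lambda>X. snd (rep X)), iso_arcs = (\<lambda>(x, e, y). e),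
    iso_head = head G, iso_tail = tail G\<rparr>"
  have Q_verts: "verts ?Q = fibre ` verts G"
    using O by (simp add: quotient_digraph_def)
  \<comment> \<open>A representative lies in its own fibre, so a tail that represents some orbit
    represents the fibre over \<open>tail G e\<close>.\<close>
  have Q_arcs: "arcs ?Q = {(x, e, y) \<in> tracial_arcs G w bp. x = rep (fibre (tail G e))}"
  proof -
    have "x \<in> rep ` ?O \<longleftrightarrow> x = rep (fibre (tail G e))" if "(x, e, y) \<in> tracial_arcs G w bp" for x e y
    proof -
      have e: "snd x = tail G e" "tail G e \<in> verts G"
        using that by (cases x; cases y; simp add: tracial_arcs_iff)+
      show ?thesis
        using e rep_fibre(2) by (auto simp: O image_image)
    qed
    moreover have "arcs ?Q = {(x, e, y) \<in> tracial_arcs G w bp. x \<in> rep ` ?O}"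
      by (auto simp: quotient_digraph_def)
    ultimately show ?thesis
      by blast
  qed
  \<comment> \<open>The head of an arc of the quotient need not be a representative; only its fibre
    matters.\<close>
  have Q_ends: "tail ?Q a = fibre (tail G (iso_arcs f a))" "head ?Q a = fibre (head G (iso_arcs f a))"
    if "a \<in> tracial_arcs G w bp" for a
    using that
    by (cases a; auto simp: quotient_digraph_def f_def tracial_arcs_iff orbit_tracial_act
        tracial_verts_step fibre_def)+
  have "wf_digraph ?Q"
  proof
    fix a assume "a \<in> arcs ?Q"
    then have "a \<in> tracial_arcs G w bp" "iso_arcs f a \<in> arcs G"
      by (auto simp: Q_arcs f_def tracial_arcs_iff)
    then show "tail ?Q a \<in> verts ?Q" "head ?Q a \<in> verts ?Q"
      by (auto simp: Q_ends Q_verts)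
  qed
  moreover have "inj_on (iso_verts f) (verts ?Q)"
    using rep_fibre by (auto simp: Q_verts f_def intro!: inj_onI)
  \<comment> \<open>The edge \<open>e\<close> fixes the tail as a chosen representative, and tail
    and edge together fix the head.\<close>
  moreover have "inj_on (iso_arcs f) (arcs ?Q)"
    by (auto simp: Q_arcs f_def tracial_arcs_iff intro!: inj_onI) (metis Pair_inject)+
  moreover have "iso_verts f (tail ?Q a) = iso_tail f (iso_arcs f a)"
    "iso_verts f (head ?Q a) = iso_head f (iso_arcs f a)" if "a \<in> arcs ?Q" for a
  proof -
    have "a \<in> tracial_arcs G w bp" "iso_arcs f a \<in> arcs G"
      using that by (auto simp: Q_arcs f_def tracial_arcs_iff)
    then show "iso_verts f (tail ?Q a) = iso_tail f (iso_arcs f a)"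
      "iso_verts f (head ?Q a) = iso_head f (iso_arcs f a)"
      by (auto simp: Q_ends rep_fibre) (auto simp: f_def rep_fibre)
  qed
  ultimately have "pre_digraph.digraph_isomorphism ?Q f"
    by (simp add: pre_digraph.digraph_isomorphism_def)
  moreover have "G = app_iso f ?Q"
  proof (rule pre_digraph.equality)
    show "verts G = verts (app_iso f ?Q)"
      by (simp add: Q_verts image_image) (simp add: f_def rep_fibre cong: image_cong_simp)
    \<comment> \<open>The preimage is the lift of \<open>e\<close> at the representative over its
      tail.\<close>
    have "e \<in> iso_arcs f ` arcs ?Q" if e: "e \<in> arcs G" for e
    proof -
      obtain l where l: "rep (fibre (tail G e)) = (l, tail G e)"
        using rep_fibre(2)[of "tail G e"] e by (metis prod.collapse tail_in_verts)
      then have "((l, tail G e), e, (l * w e, head G e)) \<in> arcs ?Q"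
        using e rep_fibre(1)[of "tail G e"] by (simp add: Q_arcs tracial_arcs_iff)
      then show ?thesis
        by (rule rev_image_eqI) (simp add: f_def)
    qed
    then show "arcs G = arcs (app_iso f ?Q)"
      by (auto simp: Q_arcs f_def tracial_arcs_iff)
  qed (simp_all add: f_def)
  moreover have "\<forall>a \<in> arcs ?Q. w (iso_arcs f a) = tracial_weight w a"
    by (auto simp: f_def tracial_weight_def)
  ultimately show ?thesis
    unfolding weighted_digraph_iso_def by blast
qed

end

theorem mainTheorem6:
  fixes G :: "('v, 'e) pre_digraph" and w :: "'e weight_fun" and bp :: 'v and \<delta> :: real
  assumes "fair_balanced_graph G w bp \<delta>"
    and "Digraph_Component.connected G"
  shows "subgroup (loop_weights G w bp) pos_real_group \<and>
    weighted_digraph_action (loop_weight_group G w bp) (tracial_cover G w bp) (tracial_weight w)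
      (tracial_act G w bp) (tracial_act_arcs G w bp) \<and>
    (\<forall>rep. orbit_representatives (loop_weight_group G w bp)
        (verts (tracial_cover G w bp)) (tracial_act G w bp) rep \<longrightarrow>
      weighted_digraph_iso
        (quotient_digraph (loop_weight_group G w bp) (tracial_act G w bp) rep (tracial_cover G w bp))
        (tracial_weight w) G w)"
proof -
  interpret fair_balanced_graph G w bp \<delta> by fact
  show ?thesis
    using subgroup_loop_weights weighted_digraph_action_tracial_cover
      weighted_digraph_iso_quotient_tracial_cover[OF assms(2)]
    by blast
qed

end
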